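(* Let $\mathcal{X}\in\mathbb{C}^{I\times I\times\cdots\times I}$ be an $N$-way symmetric tensor with an independent symmetric Tucker decomposition $\mathcal{X}=[\![\mathcal{G}^s;\mathbf{X},\mathbf{X},\ldots,\mathbf{X}]\!]$, where $\mathcal{G}^s\in\mathbb{C}^{J\times J\times\cdots\times J}$ and $\mathbf{X}\in\mathbb{C}^{I\times J}$. Then the core tensor $\mathcal{G}^s$ is also symmetric, and $\mathrm{rank}_S(\mathcal{G}^s)=\mathrm{rank}_S(\mathcal{X})$.
   Context: Mode-$n$ product: for an $N$-way tensor $\mathcal{X}\in\mathbb{C}^{I_1\times\cdots\times I_N}$ and a matrix $\mathbf{A}\in\mathbb{C}^{J\times I_n}$, $[\mathcal{X}\times_n\mathbf{A}]_{i_1\cdots i_{n-1}ji_{n+1}\cdots i_N}=\sum_{i_n=1}^{I_n}x_{i_1\cdots i_N}a_{ji_n}$. An $N$-way tensor $\mathcal{X}$ is symmetric if all its dimensions are equal and $x_{i_{\sigma(1)}\cdots i_{\sigma(N)}}=x_{i_1\cdots i_N}$ for all indices and all permutations $\sigma$ of $\{1,\ldots,N\}$. A symmetric Tucker decomposition of a symmetric tensor $\mathcal{X}\in\mathbb{C}^{I\times\cdots\times I}$ is an exact identity $\mathcal{X}=[\![\mathcal{G}^s;\mathbf{X},\ldots,\mathbf{X}]\!]:=\mathcal{G}^s\times_1\mathbf{X}\times_2\cdots\times_N\mathbf{X}$ with all factor matrices equal to one matrix $\mathbf{X}\in\mathbb{C}^{I\times J}$ and core $\mathcal{G}^s\in\mathbb{C}^{J\times\cdots\times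 J}$ (not assumed symmetric a priori). It is independent if $\mathbf{X}$ has full column rank. For a symmetric $\mathcal{X}\in\mathbb{C}^{I\times\cdots\times I}$, the symmetric rank $\mathrm{rank}_S(\mathcal{X})$ is the minimal integer $r$ such that $\mathcal{X}=\sum_{t=1}^r\mathbf{a}^{(t)}\circ\cdots\circ\mathbf{a}^{(t)}$ ($N$ factors) for some $\mathbf{a}^{(t)}\in\mathbb{C}^I$, where $\circ$ is the outer product of vectors. *)

theory Defs
  imports "HOL-Combinatorics.Permutations" "Jordan_Normal_Form.DL_Rank"
begin

text \<open>Modes and indices are counted from 0. An index of a tensor with dimension list
  \<open>ds\<close> is a list \<open>is\<close> with \<open>list_all2 (<) is ds\<close>. As for \<^typ>\<open>'a mat\<close>, entries outside this
  range are fixed to a dummy value, so that equality on the type is equality of the dimensions and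
  of all entries.\<close>

typedef 'a tensor =
  "{(ds :: nat list, f :: nat list \<Rightarrow> 'a). \<forall>is. \<not> list_all2 (<) is ds \<longrightarrow> f is = undefined}"
  by (rule exI[of _ "([], \<lambda>_. undefined)"]) simp

setup_lifting type_definition_tensor

lift_definition dims :: "'a tensor \<Rightarrow> nat list" is fst .

lift_definition entry :: "'a tensor \<Rightarrow> nat list \<Rightarrow> 'a" is snd .

lift_definition mk_tensor :: "nat list \<Rightarrow> (nat list \<Rightarrow> 'a) \<Rightarrow> 'a tensor"
  is "\<lambda>ds f. (ds, \<lambda>is. if list_all2 (<) is ds then f is else undefined)"
  by auto

lemma dims_mk_tensor [simp]: "dims (mk_tensor ds f) = ds"
  by transfer simp

lemma entry_mk_tensor [simp]: "list_all2 (<) is ds \<Longrightarrow> entry (mk_tensor ds f) is = f is"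
  by transfer simp

lemma tensor_eqI:
  assumes "dims S = dims T"
    and "\<And>is. list_all2 (<) is (dims T) \<Longrightarrow> entry S is = entry T is"
  shows "S = T"
  using assms by transfer (auto simp: fun_eq_iff, metis)

definition tensor_order :: "'a tensor \<Rightarrow> nat" where
  "tensor_order T = length (dims T)"

text \<open>Meaningful for \<open>n < tensor_order T\<close> and \<open>dim_col A = dims T ! n\<close>.\<close>

definition mode_prod :: "nat \<Rightarrow> 'a :: comm_semiring_1 tensor \<Rightarrow> 'a mat \<Rightarrow> 'a tensor" where
  "mode_prod n T A = mk_tensor ((dims T)[n := dim_row A])
     (\<lambda>is. \<Sum>k<dims T ! n. entry T (is[n := k]) * A $$ (is ! n, k))"

definition tucker :: "'a :: comm_semiring_1 tensor \<Rightarrow> 'a mat list \<Rightarrow> 'a tensor" where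
  "tucker G As = foldl (\<lambda>T n. mode_prod n T (As ! n)) G [0..<length As]"

definition symmetric_tensor :: "'a tensor \<Rightarrow> bool" where
  "symmetric_tensor T \<longleftrightarrow>
     (\<exists>I. dims T = replicate (tensor_order T) I) \<and>
     (\<forall>is \<sigma>. list_all2 (<) is (dims T) \<longrightarrow> \<sigma> permutes {..<tensor_order T} \<longrightarrow>
        entry T (permute_list \<sigma> is) = entry T is)"

definition symmetric_tucker_decomp ::
  "'a :: comm_semiring_1 tensor \<Rightarrow> 'a tensor \<Rightarrow> 'a mat \<Rightarrow> bool" where
  "symmetric_tucker_decomp T G A \<longleftrightarrow>
     dims T = replicate (tensor_order T) (dim_row A) \<and>
     dims G = replicate (tensor_order T) (dim_col A) \<and>
     T = tucker G (replicate (tensor_order T) A)"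

definition full_column_rank :: "'a :: field mat \<Rightarrow> bool" where
  "full_column_rank A \<longleftrightarrow> vec_space.rank (dim_row A) A = dim_col A"

definition independent_symmetric_tucker_decomp ::
  "'a :: field tensor \<Rightarrow> 'a tensor \<Rightarrow> 'a mat \<Rightarrow> bool" where
  "independent_symmetric_tucker_decomp T G A \<longleftrightarrow>
     symmetric_tucker_decomp T G A \<and> full_column_rank A"

definition outer_prod :: "'a :: comm_semiring_1 vec list \<Rightarrow> 'a tensor" where
  "outer_prod vs = mk_tensor (map dim_vec vs) (\<lambda>is. \<Prod>k<length vs. (vs ! k) $ (is ! k))"

definition symmetric_decomp :: "complex tensor \<Rightarrow> nat \<Rightarrow> (nat \<Rightarrow> complex vec) \<Rightarrow> bool" where
  "symmetric_decomp T r a \<longleftrightarrow>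
     (\<forall>t<r. dims (outer_prod (replicate (tensor_order T) (a t))) = dims T) \<and>
     T = mk_tensor (dims T) (\<lambda>is. \<Sum>t<r. entry (outer_prod (replicate (tensor_order T) (a t))) is)"

text \<open>Over the complex numbers every symmetric tensor of order at least 1 has a symmetric
  decomposition of some length, so the minimum exists for these. The zero tensor has rank 0.\<close>

definition symmetric_rank :: "complex tensor \<Rightarrow> nat" where
  "symmetric_rank T = (LEAST r. \<exists>a. symmetric_decomp T r a)"

end

theory Submission
  imports Defs
begin

text \<open>A matrix of full column rank has a left inverse \<open>L\<close>, and multiplying all modes by \<open>X\<close> and then
  by \<open>L\<close> is the same as multiplying them by \<open>L X = 1\<close>. So both tensors arise from each other by
  multiplying all modes with one matrix. This operation preserves symmetry, because the weight of an
  entry is a product over the modes, and it maps a decomposition with vectors \<open>a\<^sub>t\<close> to one with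
  vectors \<open>A a\<^sub>t\<close> of the same length.\<close>

section \<open>Left inverses of matrices of full column rank\<close>

text \<open>The rank is the size of a maximal independent subset of the set of columns. A repeated
  column would leave fewer than \<open>nc\<close> elements in that set.\<close>

lemma (in vec_space) full_rank_distinct_cols:
  assumes A: "A \<in> carrier_mat n nc" and rank: "rank A = nc"
  shows "distinct (cols A)"
proof -
  obtain S where S: "maximal S (\<lambda>T. T \<subseteq> set (cols A) \<and> lin_indpt T)"
    using maximal_exists_superset[of "set (cols A)" "\<lambda>T. T \<subseteq> set (cols A) \<and> lin_indpt T" "{}"]
    by (auto simp: lin_dep_def)
  then have "nc = card S" "S \<subseteq> set (cols A)"
    using rank_card_indpt[OF A S] rank by (auto simp: maximal_def)
  then have "nc \<le> card (set (cols A))"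
    by (simp add: card_mono)
  moreover have "card (set (cols A)) \<le> length (cols A)"
    by (rule card_length)
  ultimately show ?thesis
    using A by (intro card_distinct) auto
qed

text \<open>A nonzero kernel vector is a nontrivial linear relation among the columns. Linear
  dependence is a notion for sets, so the columns must be known to be distinct before the
  coordinates can serve as coefficients.\<close>

lemma full_column_rank_mult_vec_eq_0:
  assumes "full_column_rank A" and v: "v \<in> carrier_vec (dim_col A)"
    and Av: "A *\<^sub>v v = 0\<^sub>v (dim_row A)"
  shows "v = 0\<^sub>v (dim_col A)"
proof (rule ccontr)
  interpret vec_space "TYPE('a)" "dim_row A" .
  have A: "A \<in> carrier_mat (dim_row A) (dim_col A)" by simp
  have rank: "rank A = dim_col A"
    using assms(1) by (simp add: full_column_rank_def)
  have distinct: "distinct (cols A)"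
    by (rule full_rank_distinct_cols[OF A rank])
  assume "v \<noteq> 0\<^sub>v (dim_col A)"
  then show False
    using lin_depI[OF A v _ Av distinct] full_rank_lin_indpt[OF A rank distinct] by blast
qed

lemma mult_mat_vec_conjugate:
  fixes A :: "complex mat"
  assumes "dim_vec v = dim_col A"
  shows "A *\<^sub>v conjugate v = conjugate (map_mat cnj A *\<^sub>v v)"
  using assms by (auto simp: scalar_prod_def)

text \<open>The left inverse is the transpose of \<open>A\<^sup>* (A\<^sup>T A\<^sup>*)\<^sup>-\<^sup>1\<close>, where \<open>A\<^sup>*\<close> is the entrywise conjugate.\<close>

lemma full_column_rank_left_inverse:
  fixes A :: "complex mat"
  assumes A: "A \<in> carrier_mat m n" and rank: "full_column_rank A"
  obtains L where "L \<in> carrier_mat n m" "L * A = 1\<^sub>m n"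
proof -
  define C where "C = map_mat cnj A"
  define M where "M = A\<^sup>T * C"
  have C: "C \<in> carrier_mat m n" and M: "M \<in> carrier_mat n n"
    using A by (auto simp: C_def M_def)
  \<comment> \<open>\<open>M\<close> is shown to have trivial kernel. With \<open>u = C v\<close>,
    the equation \<open>M v = 0\<close> reads \<open>A\<^sup>T u = 0\<close>; pairing it with the
    conjugate of \<open>v\<close> and moving \<open>A\<close> to the other side yields the Hermitian
    square of \<open>u\<close>, which vanishes only for \<open>u = 0\<close>.\<close>
  have "v = 0\<^sub>v n" if v: "v \<in> carrier_vec n" and Mv: "M *\<^sub>v v = 0\<^sub>v n" for v
  proof -
    define u where "u = C *\<^sub>v v"
    have u: "u \<in> carrier_vec m"
      using C v by (simp add: u_def)
    have conj: "A *\<^sub>v conjugate v = conjugate u"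
      using mult_mat_vec_conjugate[of v A] A v by (simp add: u_def C_def)
    have "A\<^sup>T *\<^sub>v u = 0\<^sub>v n"
      using Mv A C v by (simp add: M_def u_def assoc_mult_mat_vec[of _ n m])
    then have "0 = (A\<^sup>T *\<^sub>v u) \<bullet> conjugate v"
      using v by simp
    also have "\<dots> = u \<bullet> (A *\<^sub>v conjugate v)"
      by (rule transpose_vec_mult_scalar[OF A]) (use u v in auto)
    finally have "u \<bullet>c u = 0"
      by (simp add: conj)
    then have "u = 0\<^sub>v m"
      using u by simp
    \<comment> \<open>Since \<open>C\<close> is the conjugate of \<open>A\<close>, it is the
      conjugate of \<open>v\<close> that lies in the kernel of \<open>A\<close>.\<close>
    then have "conjugate v = 0\<^sub>v n"
      using full_column_rank_mult_vec_eq_0[OF rank, of "conjugate v"] A v conj by simp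
    then show ?thesis
      using v by simp
  qed
  then have "det M \<noteq> 0"
    using det_0_iff_vec_prod_zero[OF M] by blast
  then obtain B where B: "B \<in> carrier_mat n n" "M * B = 1\<^sub>m n"
    using det_non_zero_imp_unit[OF M, of "()"] by (auto simp: Units_def ring_mat_def)
  \<comment> \<open>\<open>M * B = 1\<close> makes \<open>C * B\<close> a right inverse of the
    transpose of \<open>A\<close>; transposing turns it into a left inverse of
    \<open>A\<close>.\<close>
  have "(C * B)\<^sup>T * A = (A\<^sup>T * (C * B))\<^sup>T"
    using A B C by (simp add: transpose_mult[of _ n m _ n])
  also have "A\<^sup>T * (C * B) = 1\<^sub>m n"
    using A B C by (simp add: M_def assoc_mult_mat[of _ n m])
  finally show ?thesis
    using that[of "(C * B)\<^sup>T"] B C by auto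
qed

section \<open>Entries of Tucker products\<close>

lemma list_all2_less_snoc:
  "{ks. list_all2 (<) ks (ds @ [d])} =
     (\<lambda>(ks, k). ks @ [k]) ` ({ks. list_all2 (<) ks ds} \<times> {..<d :: nat})"
proof (intro equalityI subsetI)
  fix ks assume "ks \<in> {ks. list_all2 (<) ks (ds @ [d])}"
  then show "ks \<in> (\<lambda>(ks, k). ks @ [k]) ` ({ks. list_all2 (<) ks ds} \<times> {..<d})"
    by (auto simp: list_all2_append2 list_all2_Cons2 image_iff)
qed (auto intro: list_all2_appendI)

text \<open>The last mode is split off because a Tucker product applies its matrices in increasing
  order of modes, so the inductions run by \<open>rev_induct\<close>.\<close>

lemma sum_list_all2_less_snoc:
  "(\<Sum>ks | list_all2 (<) ks (ds @ [d]). f ks) =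
     (\<Sum>ks | list_all2 (<) ks ds. \<Sum>k<d :: nat. f (ks @ [k]))"
proof -
  have "inj_on (\<lambda>(ks, k). ks @ [k]) ({ks. list_all2 (<) ks ds} \<times> {..<d})"
    by (auto simp: inj_on_def)
  then show ?thesis
    unfolding list_all2_less_snoc
    by (simp add: sum.reindex sum.cartesian_product comp_def case_prod_unfold)
qed

text \<open>Distributivity: expanding the product of sums picks one summand in each mode, and these
  choices are exactly the multi-indices. It later collapses sums over multi-indices into entries of
  matrix products, mode by mode.\<close>

lemma sum_list_all2_less_prod:
  fixes f :: "nat \<Rightarrow> nat \<Rightarrow> 'a :: comm_semiring_1"
  shows "(\<Sum>ks | list_all2 (<) ks ds. \<Prod>n<length ds. f n (ks ! n)) =
    (\<Prod>n<length ds. \<Sum>k<ds ! n. f n k)"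
proof (induction ds rule: rev_induct)
  case Nil
  then show ?case by simp
next
  case (snoc d ds)
  have "(\<Sum>ks | list_all2 (<) ks (ds @ [d]). \<Prod>n<length (ds @ [d]). f n (ks ! n)) =
    (\<Sum>ks | list_all2 (<) ks ds. \<Sum>k<d. (\<Prod>n<length ds. f n (ks ! n)) * f (length ds) k)"
    unfolding sum_list_all2_less_snoc
    by (intro sum.cong refl) (auto simp: nth_append dest: list_all2_lengthD intro!: prod.cong)
  also have "\<dots> = (\<Prod>n<length ds. \<Sum>k<ds ! n. f n k) * (\<Sum>k<d. f (length ds) k)"
    by (simp add: snoc.IH[symmetric] sum_product)
  finally show ?case
    by (simp add: nth_append)
qed

section \<open>Dimensions and entries after several mode products\<close>

lemma tucker_Nil [simp]: "tucker G [] = G"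
  by (simp add: tucker_def)

lemma tucker_snoc: "tucker G (As @ [A]) = mode_prod (length As) (tucker G As) A"
proof -
  have "foldl (\<lambda>T n. mode_prod n T ((As @ [A]) ! n)) G [0..<length As] =
      foldl (\<lambda>T n. mode_prod n T (As ! n)) G [0..<length As]"
    by (rule foldl_cong) (auto simp: nth_append)
  then show ?thesis
    by (simp add: tucker_def)
qed

lemma dims_mode_prod [simp]: "dims (mode_prod n T A) = (dims T)[n := dim_row A]"
  by (simp add: mode_prod_def)

lemma dims_tucker:
  "dims G = map dim_col As @ ds \<Longrightarrow> dims (tucker G As) = map dim_row As @ ds"
  by (induction As arbitrary: ds rule: rev_induct) (simp_all add: tucker_snoc list_update_append)

text \<open>The trailing modes \<open>ds\<close>, which are not multiplied, are needed for the induction only.\<close>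

lemma entry_tucker_append:
  assumes "dims G = map dim_col As @ ds"
    and "list_all2 (<) is (map dim_row As)" "list_all2 (<) js ds"
  shows "entry (tucker G As) (is @ js) =
    (\<Sum>ks | list_all2 (<) ks (map dim_col As).
       entry G (ks @ js) * (\<Prod>n<length As. As ! n $$ (is ! n, ks ! n)))"
  using assms
proof (induction As arbitrary: "is" js ds rule: rev_induct)
  case Nil
  then show ?case by simp
next
  case (snoc A As)
  from snoc.prems(2) obtain is' i where is_eq: "is = is' @ [i]"
    and is': "list_all2 (<) is' (map dim_row As)" and i: "i < dim_row A"
    by (auto simp: list_all2_append2 list_all2_Cons2)
  have len: "length is' = length As"
    using list_all2_lengthD[OF is'] by simp
  have dims: "dims (tucker G As) = map dim_row As @ dim_col A # ds"
    using snoc.prems(1) by (intro dims_tucker) simp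
  have "entry (tucker G (As @ [A])) (is @ js) =
    (\<Sum>k<dim_col A. entry (tucker G As) (is' @ k # js) * A $$ (i, k))"
    unfolding tucker_snoc mode_prod_def dims
    using is' i snoc.prems(3)
    by (subst entry_mk_tensor)
      (auto simp: is_eq len list_update_append nth_append intro!: list_all2_appendI)
  \<comment> \<open>Mode \<open>length As\<close> is still unmultiplied in
    \<open>tucker G As\<close>, so the induction hypothesis is used with
    \<open>dim_col A # ds\<close> as trailing dimensions.\<close>
  also have "\<dots> = (\<Sum>k<dim_col A. \<Sum>ks | list_all2 (<) ks (map dim_col As).
      entry G (ks @ k # js) * (\<Prod>n<length As. As ! n $$ (is' ! n, ks ! n)) * A $$ (i, k))"
    using snoc.prems(1,3) is'
    by (intro sum.cong refl) (simp add: snoc.IH[of "dim_col A # ds"] sum_distrib_right)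
  \<comment> \<open>After the sums are swapped, \<open>ks\<close> and \<open>k\<close> merge into
    one multi-index \<open>ks @ [k]\<close>, and the factor from \<open>A\<close> becomes the last
    one of the product.\<close>
  also have "\<dots> = (\<Sum>ks | list_all2 (<) ks (map dim_col As @ [dim_col A]).
      entry G (ks @ js) * (\<Prod>n<length (As @ [A]). (As @ [A]) ! n $$ (is ! n, ks ! n)))"
    unfolding sum_list_all2_less_snoc
    by (subst sum.swap, intro sum.cong refl)
      (auto simp: nth_append is_eq len mult.assoc dest!: list_all2_lengthD intro!: prod.cong
        arg_cong2[of _ _ _ _ "(*)"])
  finally show ?case
    by simp
qed

lemma entry_tucker:
  assumes "dims G = map dim_col As" and "list_all2 (<) is (map dim_row As)"
  shows "entry (tucker G As) is =
    (\<Sum>ks | list_all2 (<) ks (map dim_col As).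
       entry G ks * (\<Prod>n<length As. As ! n $$ (is ! n, ks ! n)))"
  using entry_tucker_append[of G As "[]" "is" "[]"] assms by simp

lemma entry_tucker_replicate:
  assumes "dims G = replicate N (dim_col A)" and "list_all2 (<) is (replicate N (dim_row A))"
  shows "entry (tucker G (replicate N A)) is =
    (\<Sum>ks | list_all2 (<) ks (replicate N (dim_col A)).
       entry G ks * (\<Prod>n<N. A $$ (is ! n, ks ! n)))"
  using assms by (simp add: entry_tucker)

lemma dims_tucker_replicate:
  "dims G = replicate N (dim_col A) \<Longrightarrow> dims (tucker G (replicate N A)) = replicate N (dim_row A)"
  using dims_tucker[of G "replicate N A" "[]"] by simp

lemma list_all2_less_replicate_nth:
  "list_all2 (<) ks (replicate N d) \<Longrightarrow> n < N \<Longrightarrow> ks ! n < d"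
  by (auto simp: list_all2_conv_all_nth)

lemma finite_list_all2_less: "finite {ks. list_all2 (<) ks (ds :: nat list)}"
  by (induction ds rule: rev_induct) (simp_all add: list_all2_less_snoc)

section \<open>Composition of products in all modes, and the identity matrix\<close>

lemma tucker_replicate_mult:
  assumes G: "dims G = replicate N (dim_col A)" and BA: "dim_col B = dim_row A"
  shows "tucker (tucker G (replicate N A)) (replicate N B) = tucker G (replicate N (B * A))"
proof (rule tensor_eqI)
  let ?K = "{ks. list_all2 (<) ks (replicate N (dim_col A))}"
  let ?J = "{js. list_all2 (<) js (replicate N (dim_row A))}"
  have GA: "dims (tucker G (replicate N A)) = replicate N (dim_col B)"
    using G BA by (simp add: dims_tucker_replicate)
  have GBA: "dims (tucker G (replicate N (B * A))) = replicate N (dim_row B)"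
    using G by (simp add: dims_tucker_replicate)
  show "dims (tucker (tucker G (replicate N A)) (replicate N B)) =
      dims (tucker G (replicate N (B * A)))"
    using GA GBA by (simp add: dims_tucker_replicate)
  fix "is" assume "list_all2 (<) is (dims (tucker G (replicate N (B * A))))"
  then have "is": "list_all2 (<) is (replicate N (dim_row B))"
    by (simp add: GBA)
  \<comment> \<open>For fixed \<open>ks\<close> the factor of mode \<open>n\<close> depends on
    \<open>js\<close> only through \<open>js ! n\<close>. The sum over the intermediate index
    therefore splits into one sum per mode, each an entry of \<open>B * A\<close>.\<close>
  have prod: "(\<Sum>js\<in>?J. \<Prod>n<N. A $$ (js ! n, ks ! n) * B $$ (is ! n, js ! n)) =
      (\<Prod>n<N. (B * A) $$ (is ! n, ks ! n))" if ks: "ks \<in> ?K" for ks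
  proof -
    have "(\<Sum>js\<in>?J. \<Prod>n<N. A $$ (js ! n, ks ! n) * B $$ (is ! n, js ! n)) =
        (\<Prod>n<N. \<Sum>j<dim_row A. A $$ (j, ks ! n) * B $$ (is ! n, j))"
      using sum_list_all2_less_prod[where ds = "replicate N (dim_row A)" and
            f = "\<lambda>n j. A $$ (j, ks ! n) * B $$ (is ! n, j)"] by simp
    also have "\<dots> = (\<Prod>n<N. (B * A) $$ (is ! n, ks ! n))"
      using ks "is" BA
      by (intro prod.cong refl)
        (auto simp: scalar_prod_def mult.commute atLeast0LessThan
          dest!: list_all2_less_replicate_nth intro!: sum.cong)
    finally show ?thesis .
  qed
  have "entry (tucker (tucker G (replicate N A)) (replicate N B)) is =
      (\<Sum>js\<in>?J. entry (tucker G (replicate N A)) js * (\<Prod>n<N. B $$ (is ! n, js ! n)))"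
    using entry_tucker_replicate[OF GA "is"] BA by simp
  also have "\<dots> = (\<Sum>js\<in>?J. \<Sum>ks\<in>?K. entry G ks *
      (\<Prod>n<N. A $$ (js ! n, ks ! n) * B $$ (is ! n, js ! n)))"
    using G by (intro sum.cong refl)
      (simp add: entry_tucker_replicate sum_distrib_right mult.assoc prod.distrib)
  also have "\<dots> = (\<Sum>ks\<in>?K. entry G ks * (\<Prod>n<N. (B * A) $$ (is ! n, ks ! n)))"
    by (subst sum.swap, intro sum.cong refl) (simp add: sum_distrib_left[symmetric] prod)
  also have "\<dots> = entry (tucker G (replicate N (B * A))) is"
    using entry_tucker_replicate[of G N "B * A" "is"] G "is" by simp
  finally show "entry (tucker (tucker G (replicate N A)) (replicate N B)) is =
      entry (tucker G (replicate N (B * A))) is" .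
qed

lemma tucker_replicate_one:
  fixes G :: "'a :: comm_semiring_1 tensor"
  assumes G: "dims G = replicate N J"
  shows "tucker G (replicate N (1\<^sub>m J)) = G"
proof (rule tensor_eqI)
  show "dims (tucker G (replicate N (1\<^sub>m J))) = dims G"
    using G by (simp add: dims_tucker_replicate)
  fix "is" assume "list_all2 (<) is (dims G)"
  then have "is": "list_all2 (<) is (replicate N J)"
    by (simp add: G)
  let ?K = "{ks. list_all2 (<) ks (replicate N J)}"
  \<comment> \<open>The weights of the identity form a Kronecker delta on multi-indices: any mode in
    which the two indices differ contributes a factor 0.\<close>
  have delta: "(\<Prod>n<N. 1\<^sub>m J $$ (is ! n, ks ! n)) = (if ks = is then 1 else 0 :: 'a)"
    if ks: "ks \<in> ?K" for ks
  proof (cases "ks = is")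
    case True
    then show ?thesis
      using "is" by (auto dest: list_all2_less_replicate_nth intro!: prod.neutral)
  next
    case False
    have "length ks = N" "length is = N"
      using ks "is" by (auto dest: list_all2_lengthD)
    with False obtain n where "n < N" "ks ! n \<noteq> is ! n"
      by (auto simp: list_eq_iff_nth_eq)
    then show ?thesis
      using False ks "is" list_all2_less_replicate_nth[of _ N J n]
      by (auto intro!: prod_zero bexI[of _ n])
  qed
  have "entry (tucker G (replicate N (1\<^sub>m J))) is =
      (\<Sum>ks\<in>?K. entry G ks * (if ks = is then 1 else 0))"
    using G "is" by (simp add: entry_tucker_replicate delta)
  also have "\<dots> = entry G is"
    using "is" by (simp add: if_distrib[of "(*) _"] finite_list_all2_less cong: if_cong)
  finally show "entry (tucker G (replicate N (1\<^sub>m J))) is = entry G is" .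
qed

section \<open>Multiplying all modes by one matrix\<close>

text \<open>When all dimensions agree, being in range depends only on the length and the set of
  elements of the list, and a permutation changes neither.\<close>

lemma permute_list_in_replicate_iff:
  assumes "\<sigma> permutes {..<N}"
  shows "list_all2 (<) (permute_list \<sigma> ks) (replicate N d) \<longleftrightarrow> list_all2 (<) ks (replicate N d)"
proof -
  have "list_all2 (<) xs (replicate N d) \<longleftrightarrow> length xs = N \<and> (\<forall>x\<in>set xs. x < d)" for xs
    by (force simp: list_all2_conv_all_nth in_set_conv_nth)
  then show ?thesis
    using assms by auto
qed

lemma symmetric_tensor_tucker_replicate:
  assumes G: "dims G = replicate N (dim_col A)" and sym: "symmetric_tensor G"
  shows "symmetric_tensor (tucker G (replicate N A))"
proof -
  let ?T = "tucker G (replicate N A)"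
  let ?K = "{ks. list_all2 (<) ks (replicate N (dim_col A))}"
  have dims: "dims ?T = replicate N (dim_row A)"
    using G by (rule dims_tucker_replicate)
  then have order: "tensor_order ?T = N"
    by (simp add: tensor_order_def)
  have "entry ?T (permute_list \<sigma> is) = entry ?T is"
    if "is": "list_all2 (<) is (replicate N (dim_row A))" and \<sigma>: "\<sigma> permutes {..<N}" for "is" \<sigma>
  proof -
    have len: "length is = N"
      using list_all2_lengthD[OF "is"] by simp
    define \<tau> where "\<tau> = inv_into UNIV \<sigma>"
    have \<tau>: "\<tau> permutes {..<N}" "\<tau> \<circ> \<sigma> = id" "\<sigma> \<circ> \<tau> = id"
      unfolding \<tau>_def using permutes_inv[OF \<sigma>] permutes_inv_o[OF \<sigma>] by auto
    have inv_inv: "permute_list \<sigma> (permute_list \<tau> ks) = ks"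
      "permute_list \<tau> (permute_list \<sigma> ks) = ks" if "ks \<in> ?K" for ks
    proof -
      have "length ks = N"
        using that by (auto dest: list_all2_lengthD)
      then show "permute_list \<sigma> (permute_list \<tau> ks) = ks"
        "permute_list \<tau> (permute_list \<sigma> ks) = ks"
        using permute_list_compose[of \<sigma> ks \<tau>] permute_list_compose[of \<tau> ks \<sigma>]
          \<sigma> \<tau> by simp_all
    qed
    have "entry ?T (permute_list \<sigma> is) =
        (\<Sum>ks\<in>?K. entry G ks * (\<Prod>n<N. A $$ (permute_list \<sigma> is ! n, ks ! n)))"
      using G "is" \<sigma> by (simp add: entry_tucker_replicate permute_list_in_replicate_iff)
    \<comment> \<open>Substituting \<open>permute_list \<sigma> ks\<close> for \<open>ks\<close>
      permutes both arguments of the weight in the same way; \<open>permute_list \<tau>\<close>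
      witnesses that the substitution is a bijection of the index set.\<close>
    also have "\<dots> = (\<Sum>ks\<in>?K. entry G (permute_list \<sigma> ks) *
        (\<Prod>n<N. A $$ (permute_list \<sigma> is ! n, permute_list \<sigma> ks ! n)))"
      by (rule sum.reindex_bij_witness[of _ "permute_list \<sigma>" "permute_list \<tau>"])
        (use \<sigma> \<tau>(1) in \<open>auto simp: inv_inv permute_list_in_replicate_iff\<close>)
    also have "\<dots> = (\<Sum>ks\<in>?K. entry G ks * (\<Prod>n<N. A $$ (is ! n, ks ! n)))"
    proof (intro sum.cong refl arg_cong2[of _ _ _ _ "(*)"])
      fix ks assume "ks \<in> ?K"
      then have ks: "list_all2 (<) ks (replicate N (dim_col A))" "length ks = N"
        by (auto dest: list_all2_lengthD)
      show "entry G (permute_list \<sigma> ks) = entry G ks"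
        using sym ks(1) \<sigma> G by (auto simp: symmetric_tensor_def tensor_order_def)
      \<comment> \<open>The factor at \<open>n\<close> is now the original factor at
        \<open>\<sigma> n\<close>, so the product is merely reordered.\<close>
      have "(\<Prod>n<N. A $$ (permute_list \<sigma> is ! n, permute_list \<sigma> ks ! n)) =
          (\<Prod>n<N. A $$ (is ! \<sigma> n, ks ! \<sigma> n))"
        using \<sigma> ks len by (intro prod.cong refl) (simp add: permute_list_nth)
      also have "\<dots> = (\<Prod>n<N. A $$ (is ! n, ks ! n))"
        using prod.permute[OF \<sigma>, of "\<lambda>n. A $$ (is ! n, ks ! n)"] by (simp add: comp_def)
      finally show "(\<Prod>n<N. A $$ (permute_list \<sigma> is ! n, permute_list \<sigma> ks ! n)) =
          (\<Prod>n<N. A $$ (is ! n, ks ! n))" .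
    qed
    also have "\<dots> = entry ?T is"
      using G "is" by (simp add: entry_tucker_replicate)
    finally show ?thesis .
  qed
  then show ?thesis
    unfolding symmetric_tensor_def order dims by blast
qed

section \<open>Transport of symmetric decompositions\<close>

lemma dims_outer_prod [simp]: "dims (outer_prod vs) = map dim_vec vs"
  by (simp add: outer_prod_def)

lemma entry_outer_prod_replicate:
  assumes "list_all2 (<) is (replicate N (dim_vec v))"
  shows "entry (outer_prod (replicate N v)) is = (\<Prod>n<N. v $ (is ! n))"
  using assms by (simp add: outer_prod_def)

text \<open>Multiplying all modes is linear in the tensor and sends the outer power of a vector
  \<open>v\<close> to that of \<open>A *\<^sub>v v\<close>, so it can be carried out summand by
  summand.\<close>

lemma symmetric_decomp_tucker_replicate:
  assumes T: "dims T = replicate N (dim_col A)" and dec: "symmetric_decomp T r a"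
  shows "symmetric_decomp (tucker T (replicate N A)) r (\<lambda>t. A *\<^sub>v a t)"
proof -
  let ?T = "tucker T (replicate N A)"
  let ?K = "{ks. list_all2 (<) ks (replicate N (dim_col A))}"
  have order: "tensor_order T = N"
    using T by (simp add: tensor_order_def)
  have dims: "dims ?T = replicate N (dim_row A)"
    using T by (rule dims_tucker_replicate)
  then have orderT: "tensor_order ?T = N"
    by (simp add: tensor_order_def)
  \<comment> \<open>The equation is between replicated lists because for \<open>N = 0\<close> the
    decomposition does not constrain \<open>dim_vec (a t)\<close>; the dimension itself is extracted
    below only in the presence of some \<open>n < N\<close>.\<close>
  have dims_a: "replicate N (dim_vec (a t)) = replicate N (dim_col A)" if "t < r" for t
    using dec T that by (simp add: symmetric_decomp_def order)
  have entry_T: "entry T ks = (\<Sum>t<r. \<Prod>n<N. a t $ (ks ! n))" if "ks \<in> ?K" for ks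
  proof -
    have "entry T ks = (\<Sum>t<r. entry (outer_prod (replicate N (a t))) ks)"
      using dec that T unfolding symmetric_decomp_def order
      by (metis (no_types, lifting) entry_mk_tensor mem_Collect_eq)
    then show ?thesis
      using that by (simp add: entry_outer_prod_replicate dims_a)
  qed
  have "?T = mk_tensor (dims ?T)
      (\<lambda>is. \<Sum>t<r. entry (outer_prod (replicate N (A *\<^sub>v a t))) is)"
  proof (rule tensor_eqI)
    fix "is" assume "list_all2 (<) is
      (dims (mk_tensor (dims ?T) (\<lambda>is. \<Sum>t<r. entry (outer_prod (replicate N (A *\<^sub>v a t))) is)))"
    then have "is": "list_all2 (<) is (replicate N (dim_row A))"
      by (simp add: dims)
    have "entry ?T is =
        (\<Sum>ks\<in>?K. \<Sum>t<r. \<Prod>n<N. a t $ (ks ! n) * A $$ (is ! n, ks ! n))"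
      using T "is" by (simp add: entry_tucker_replicate entry_T sum_distrib_right prod.distrib)
    also have "\<dots> = (\<Sum>t<r. \<Sum>ks\<in>?K. \<Prod>n<N. a t $ (ks ! n) * A $$ (is ! n, ks ! n))"
      by (rule sum.swap)
    also have "\<dots> = (\<Sum>t<r. entry (outer_prod (replicate N (A *\<^sub>v a t))) is)"
    proof (intro sum.cong refl)
      fix t assume "t \<in> {..<r}"
      then have dim: "dim_vec (a t) = dim_col A" if "n < N" for n
        using dims_a[of t] that by (metis lessThan_iff nth_replicate)
      \<comment> \<open>For a single \<open>t\<close> the summand is a product of factors each
        depending on one coordinate of \<open>ks\<close>, so distributivity applies and leaves in
        mode \<open>n\<close> the entry of \<open>A *\<^sub>v a t\<close> at
        \<open>is ! n\<close>.\<close>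
      have "(\<Sum>ks\<in>?K. \<Prod>n<N. a t $ (ks ! n) * A $$ (is ! n, ks ! n)) =
          (\<Prod>n<N. \<Sum>k<dim_col A. a t $ k * A $$ (is ! n, k))"
        using sum_list_all2_less_prod[where ds = "replicate N (dim_col A)" and
            f = "\<lambda>n k. a t $ k * A $$ (is ! n, k)"] by simp
      also have "\<dots> = (\<Prod>n<N. (A *\<^sub>v a t) $ (is ! n))"
        using list_all2_less_replicate_nth[OF "is"] dim
        by (intro prod.cong refl)
          (auto simp: scalar_prod_def mult.commute atLeast0LessThan intro!: sum.cong)
      also have "\<dots> = entry (outer_prod (replicate N (A *\<^sub>v a t))) is"
        using "is" by (simp add: entry_outer_prod_replicate)
      finally show "(\<Sum>ks\<in>?K. \<Prod>n<N. a t $ (ks ! n) * A $$ (is ! n, ks ! n)) =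
          entry (outer_prod (replicate N (A *\<^sub>v a t))) is" .
    qed
    finally show "entry ?T is = entry (mk_tensor (dims ?T)
        (\<lambda>is. \<Sum>t<r. entry (outer_prod (replicate N (A *\<^sub>v a t))) is)) is"
      using "is" by (simp add: dims)
  qed simp
  then show ?thesis
    unfolding symmetric_decomp_def orderT by (simp add: dims)
qed

theorem theorem5:
  fixes \<X> \<G> :: "complex tensor" and X :: "complex mat" and N I J :: nat
  assumes "N \<ge> 1"
    and "dims \<X> = replicate N I"
    and "dims \<G> = replicate N J"
    and "X \<in> carrier_mat I J"
    and "symmetric_tensor \<X>"
    and "independent_symmetric_tucker_decomp \<X> \<G> X"
  shows "symmetric_tensor \<G> \<and> symmetric_rank \<G> = symmetric_rank \<X>"
proof -
  have X: "dim_row X = I" "dim_col X = J"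
    using assms(4) by auto
  have order: "tensor_order \<X> = N"
    using assms(2) by (simp add: tensor_order_def)
  have \<X>: "\<X> = tucker \<G> (replicate N X)" and rank: "full_column_rank X"
    using assms(6) by (simp_all add: independent_symmetric_tucker_decomp_def
        symmetric_tucker_decomp_def order)
  obtain L where L: "L \<in> carrier_mat J I" "L * X = 1\<^sub>m J"
    using full_column_rank_left_inverse[OF assms(4) rank] .
  have "tucker \<X> (replicate N L) = tucker \<G> (replicate N (L * X))"
    unfolding \<X> using assms(3) L X by (intro tucker_replicate_mult) auto
  then have \<G>: "\<G> = tucker \<X> (replicate N L)"
    using assms(3) L by (simp add: tucker_replicate_one)
  have "symmetric_tensor \<G>"
    unfolding \<G> using assms(2,5) L by (intro symmetric_tensor_tucker_replicate) auto
  \<comment> \<open>\<open>X\<close> transports decompositions in one direction and \<open>L\<close>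
    in the other, both keeping \<open>r\<close>. The two ranks are thus least elements of the same
    set of lengths.\<close>
  moreover have "(\<exists>a. symmetric_decomp \<G> r a) \<longleftrightarrow> (\<exists>a. symmetric_decomp \<X> r a)" for r
  proof
    assume "\<exists>a. symmetric_decomp \<G> r a"
    then show "\<exists>a. symmetric_decomp \<X> r a"
      using symmetric_decomp_tucker_replicate[of \<G> N X] assms(3) X \<X> by auto
  next
    assume "\<exists>a. symmetric_decomp \<X> r a"
    then show "\<exists>a. symmetric_decomp \<G> r a"
      using symmetric_decomp_tucker_replicate[of \<X> N L] assms(2) L \<G> by auto
  qed
  ultimately show ?thesis
    by (simp add: symmetric_rank_def)
qed

end
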